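(* Let $(M,g)$ be a spacetime and let $$D^{+}_f=\{(x,y)\in M\times M: y\in\overline{I^{+}(x)}\},\qquad D^{+}_p=\{(x,y)\in M\times M: x\in\overline{I^{-}(y)}\}.$$ The causal relations $D^{+}_f$ and $D^{+}_p$ are reflexive and transitive. Moreover, $D^{+}_f$ (resp. $D^{+}_p$) is antisymmetric, and hence a (reflexive) partial order, if and only if the spacetime is future (resp. past) distinguishing.
   Context: A spacetime $(M,g)$ is a connected, time-oriented $C^{r}$ Lorentzian manifold ($r\in\{3,\dots,\infty\}$) of dimension $n\ge 2$ and signature $(-,+,\dots,+)$. $p\ll q$ means that there is a future-directed timelike curve from $p$ to $q$; $I^{+}=\{(p,q)\in M\times M:p\ll q\}$, $I^{+}(x)=\{y:x\ll y\}$, $I^{-}(x)=\{y:y\ll x\}$. Overline denotes topological closure in $M$. A causal relation is a subset of $M\times M$ containing $I^{+}$. A relation $R^{+}\subset M\times M$ is antisymmetric if $(x,z)\in R^{+}$ and $(z,x)\in R^{+}$ imply $x=z$. $(M,g)$ is future (resp. past) distinguishing if for all $x,z\in M$, $I^{+}(x)=I^{+}(z)$ (resp. $I^{-}(x)=I^{-}(z)$) implies $x=z$. *)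

theory Defs
  imports "HOL-Analysis.Analysis" "HOL-Library.Extended_Nat"
begin

text \<open>
  \<open>C\<^sup>k\<close> maps on an open set \<open>S\<close>: all iterated directional derivatives up to order \<open>k\<close>
  exist (in the Frechet sense) and are continuous. \<open>C_on\<close> extends this to \<open>k = \<infinity>\<close>.
\<close>

fun Ck_on :: "nat \<Rightarrow> ('a::real_normed_vector \<Rightarrow> 'b::real_normed_vector) \<Rightarrow> 'a set \<Rightarrow> bool" where
  "Ck_on 0 f S \<longleftrightarrow> continuous_on S f"
| "Ck_on (Suc k) f S \<longleftrightarrow>
     (\<forall>x\<in>S. f differentiable (at x)) \<and> (\<forall>v. Ck_on k (\<lambda>x. frechet_derivative f (at x) v) S)"

definition C_on :: "enat \<Rightarrow> ('a::real_normed_vector \<Rightarrow> 'b::real_normed_vector) \<Rightarrow> 'a set \<Rightarrow> bool" where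
  "C_on r f S \<longleftrightarrow> (\<forall>k. enat k \<le> r \<longrightarrow> Ck_on k f S)"

text \<open>
  A chart is a pair of its domain and its coordinate map (whose values off the domain are
  irrelevant). A tangent vector at \<open>p\<close> is represented by its components in all the charts around
  \<open>p\<close>, related by the usual transformation law; it is \<open>0\<close> on all other arguments.
\<close>

type_synonym ('m, 'e) chart = "'m set \<times> ('m \<Rightarrow> 'e)"
type_synonym ('m, 'e) tvector = "('m, 'e) chart \<Rightarrow> 'e"

text \<open>
  The data of a time-oriented Lorentzian manifold. The field \<open>future p\<close> is the set of
  future-directed timelike vectors at \<open>p\<close>.
\<close>

record ('m, 'e) lorentz =
  topol :: "'m topology"
  atlas :: "('m, 'e) chart set"
  metric :: "'m \<Rightarrow> ('m, 'e) tvector \<Rightarrow> ('m, 'e) tvector \<Rightarrow> real"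
  future :: "'m \<Rightarrow> ('m, 'e) tvector set"

abbreviation points :: "('m, 'e) lorentz \<Rightarrow> 'm set" where
  "points M \<equiv> topspace (topol M)"

definition param :: "('m, 'e) chart \<Rightarrow> 'e \<Rightarrow> 'm" where
  "param c = inv_into (fst c) (snd c)"

definition transition :: "('m, 'e) chart \<Rightarrow> ('m, 'e) chart \<Rightarrow> 'e \<Rightarrow> 'e" where
  "transition c d = snd d \<circ> param c"

definition charts_at :: "('m, 'e) lorentz \<Rightarrow> 'm \<Rightarrow> ('m, 'e) chart set" where
  "charts_at M p = {c \<in> atlas M. p \<in> fst c}"

text \<open>The atlas is not required to be maximal.\<close>

definition Cr_manifold :: "enat \<Rightarrow> ('m, 'e::euclidean_space) lorentz \<Rightarrow> bool" where
  "Cr_manifold r M \<longleftrightarrow>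
     Hausdorff_space (topol M) \<and> second_countable (topol M) \<and>
     (\<forall>c \<in> atlas M. openin (topol M) (fst c) \<and> open (snd c ` fst c) \<and>
        homeomorphic_map (subtopology (topol M) (fst c)) (top_of_set (snd c ` fst c)) (snd c)) \<and>
     (\<Union>c \<in> atlas M. fst c) = points M \<and>
     (\<forall>c \<in> atlas M. \<forall>d \<in> atlas M. C_on r (transition c d) (snd c ` (fst c \<inter> fst d)))"

definition tangent_space :: "('m, 'e::euclidean_space) lorentz \<Rightarrow> 'm \<Rightarrow> ('m, 'e) tvector set" where
  "tangent_space M p =
     {v. (\<forall>c \<in> charts_at M p. \<forall>d \<in> charts_at M p.
            v d = frechet_derivative (transition c d) (at (snd c p)) (v c)) \<and>
         (\<forall>c. c \<notin> charts_at M p \<longrightarrow> v c = 0)}"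

text \<open>The tangent vector at \<open>p\<close> whose component in the chart \<open>c\<close> is \<open>u\<close>.\<close>

definition tangent_of ::
    "('m, 'e::euclidean_space) lorentz \<Rightarrow> 'm \<Rightarrow> ('m, 'e) chart \<Rightarrow> 'e \<Rightarrow> ('m, 'e) tvector" where
  "tangent_of M p c u =
     (\<lambda>d. if d \<in> charts_at M p
          then frechet_derivative (transition c d) (at (snd c p)) u else 0)"

text \<open>The coordinate expression of the metric in the chart \<open>c\<close>, at the coordinate point \<open>x\<close>.\<close>

definition metric_in ::
    "('m, 'e::euclidean_space) lorentz \<Rightarrow> ('m, 'e) chart \<Rightarrow> 'e \<Rightarrow> 'e \<Rightarrow> 'e \<Rightarrow> real" where
  "metric_in M c x u w =
     metric M (param c x) (tangent_of M (param c x) c u) (tangent_of M (param c x) c w)"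

text \<open>Symmetric bilinear forms of signature \<open>(-,+,...,+)\<close>.\<close>

definition lorentzian_form :: "('e::euclidean_space \<Rightarrow> 'e \<Rightarrow> real) \<Rightarrow> bool" where
  "lorentzian_form b \<longleftrightarrow>
     bilinear b \<and> (\<forall>u w. b u w = b w u) \<and>
     (\<exists>B t. independent B \<and> span B = UNIV \<and> t \<in> B \<and> b t t = -1 \<and>
        (\<forall>u \<in> B - {t}. b u u = 1) \<and> (\<forall>u \<in> B. \<forall>w \<in> B. u \<noteq> w \<longrightarrow> b u w = 0))"

text \<open>
  On a \<open>C\<^sup>r\<close> manifold the tangent bundle is \<open>C\<^bsup>r-1\<^esup>\<close>, so that a metric is
  of class \<open>C\<^bsup>r-1\<^esup>\<close>; for \<open>r = \<infinity>\<close>, subtraction on \<open>enat\<close> gives \<open>r - 1 = \<infinity>\<close>.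
\<close>

definition lorentzian_metric :: "enat \<Rightarrow> ('m, 'e::euclidean_space) lorentz \<Rightarrow> bool" where
  "lorentzian_metric r M \<longleftrightarrow>
     (\<forall>c \<in> atlas M.
        (\<forall>x \<in> snd c ` fst c. lorentzian_form (metric_in M c x)) \<and>
        (\<forall>u w. C_on (r - 1) (\<lambda>x. metric_in M c x u w) (snd c ` fst c)))"

definition timelike_vectors :: "('m, 'e::euclidean_space) lorentz \<Rightarrow> 'm \<Rightarrow> ('m, 'e) tvector set" where
  "timelike_vectors M p = {v \<in> tangent_space M p. metric M p v v < 0}"

text \<open>
  A time orientation is a continuous choice of one of the two timelike cones at every point:
  near each point, it is the choice of the cones that contain some continuous timelike vector field.
\<close>

definition time_orientation :: "('m, 'e::euclidean_space) lorentz \<Rightarrow> bool" where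
  "time_orientation M \<longleftrightarrow>
     (\<forall>p \<in> points M. \<exists>U X. openin (topol M) U \<and> p \<in> U \<and>
        (\<forall>q \<in> U. X q \<in> timelike_vectors M q) \<and>
        (\<forall>c \<in> atlas M.
           continuous_map (subtopology (topol M) (U \<inter> fst c)) euclidean (\<lambda>q. X q c)) \<and>
        (\<forall>q \<in> U. future M q = {v \<in> timelike_vectors M q. metric M q (X q) v < 0}))"

definition spacetime :: "enat \<Rightarrow> ('m, 'e::euclidean_space) lorentz \<Rightarrow> bool" where
  "spacetime r M \<longleftrightarrow>
     3 \<le> r \<and> 2 \<le> DIM('e) \<and> Cr_manifold r M \<and> connected_space (topol M) \<and>
     lorentzian_metric r M \<and> time_orientation M"

text \<open>
  Timelike curves are piecewise \<open>C\<^sup>1\<close>, with a finite set \<open>S\<close> of break points at which both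
  one-sided velocities are future-directed timelike. The velocity at a parameter \<open>t\<close> is taken within the
  interval \<open>I\<close>, hence is one-sided at its end points.
\<close>

definition velocity ::
    "('m, 'e::euclidean_space) lorentz \<Rightarrow> (real \<Rightarrow> 'm) \<Rightarrow> real set \<Rightarrow> real \<Rightarrow> ('m, 'e) tvector" where
  "velocity M \<gamma> I t =
     (\<lambda>c. if c \<in> charts_at M (\<gamma> t)
          then vector_derivative (snd c \<circ> \<gamma>) (at t within I) else 0)"

definition C1_curve :: "('m, 'e::euclidean_space) lorentz \<Rightarrow> (real \<Rightarrow> 'm) \<Rightarrow> real set \<Rightarrow> bool" where
  "C1_curve M \<gamma> I \<longleftrightarrow>
     continuous_map (top_of_set I) (topol M) \<gamma> \<and>
     (\<forall>c \<in> atlas M.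
        (\<forall>t \<in> I \<inter> \<gamma> -` fst c. (snd c \<circ> \<gamma>) differentiable (at t within I)) \<and>
        continuous_on (I \<inter> \<gamma> -` fst c) (\<lambda>t. velocity M \<gamma> I t c))"

definition future_timelike_curve ::
    "('m, 'e::euclidean_space) lorentz \<Rightarrow> (real \<Rightarrow> 'm) \<Rightarrow> real \<Rightarrow> real \<Rightarrow> bool" where
  "future_timelike_curve M \<gamma> a b \<longleftrightarrow>
     a < b \<and> continuous_map (top_of_set {a..b}) (topol M) \<gamma> \<and>
     (\<exists>S. finite S \<and> {a, b} \<subseteq> S \<and> S \<subseteq> {a..b} \<and>
        (\<forall>s \<in> S. \<forall>t \<in> S. s < t \<and> S \<inter> {s<..<t} = {} \<longrightarrow>
           C1_curve M \<gamma> {s..t} \<and> (\<forall>\<tau> \<in> {s..t}. velocity M \<gamma> {s..t} \<tau> \<in> future M (\<gamma> \<tau>))))"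

definition chron_rel :: "('m, 'e::euclidean_space) lorentz \<Rightarrow> ('m \<times> 'm) set" where
  "chron_rel M =
     {(p, q). \<exists>\<gamma> a b. future_timelike_curve M \<gamma> a b \<and> \<gamma> a = p \<and> \<gamma> b = q}"

definition chron_future :: "('m, 'e::euclidean_space) lorentz \<Rightarrow> 'm \<Rightarrow> 'm set" where
  "chron_future M x = {y. (x, y) \<in> chron_rel M}"

definition chron_past :: "('m, 'e::euclidean_space) lorentz \<Rightarrow> 'm \<Rightarrow> 'm set" where
  "chron_past M x = {y. (y, x) \<in> chron_rel M}"

definition causal_relation :: "('m, 'e::euclidean_space) lorentz \<Rightarrow> ('m \<times> 'm) set \<Rightarrow> bool" where
  "causal_relation M R \<longleftrightarrow> chron_rel M \<subseteq> R \<and> R \<subseteq> points M \<times> points M"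

definition future_distinguishing :: "('m, 'e::euclidean_space) lorentz \<Rightarrow> bool" where
  "future_distinguishing M \<longleftrightarrow>
     (\<forall>x \<in> points M. \<forall>z \<in> points M. chron_future M x = chron_future M z \<longrightarrow> x = z)"

definition past_distinguishing :: "('m, 'e::euclidean_space) lorentz \<Rightarrow> bool" where
  "past_distinguishing M \<longleftrightarrow>
     (\<forall>x \<in> points M. \<forall>z \<in> points M. chron_past M x = chron_past M z \<longrightarrow> x = z)"

definition D_future :: "('m, 'e::euclidean_space) lorentz \<Rightarrow> ('m \<times> 'm) set" where
  "D_future M = {(x, y) \<in> points M \<times> points M. y \<in> topol M closure_of chron_future M x}"

definition D_past :: "('m, 'e::euclidean_space) lorentz \<Rightarrow> ('m \<times> 'm) set" where
  "D_past M = {(x, y) \<in> points M \<times> points M. x \<in> topol M closure_of chron_past M y}"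

end

theory Submission
  imports Defs
begin

text \<open>
  The chronological relation is the transitive closure of the relation given by single
  \<open>C\<^sup>1\<close> pieces of timelike curves. In a chart the future cones form an open set of pairs
  (point, velocity), so a timelike piece stays timelike under a small \<open>C\<^sup>1\<close> perturbation
  of its start; hence \<open>I\<^sup>-(q)\<close> is open. A short straight segment in a future
  direction shows that \<open>x\<close> lies in the closure of \<open>I\<^sup>+(x)\<close>. Openness of the pasts turns
  \<open>y \<in> closure I\<^sup>+(x)\<close> into \<open>I\<^sup>+(y) \<subseteq> I\<^sup>+(x)\<close>, from which transitivity and the
  characterisation of antisymmetry follow. The statements on pasts are those on futures for the
  opposite time orientation.
\<close>

section \<open>Timelike pieces\<close>

text \<open>A stretch of a timelike curve between consecutive break points:
  \<open>future_timelike_curve\<close> asks for exactly this condition on each such stretch.\<close>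

definition timelike_piece ::
    "('m, 'e::euclidean_space) lorentz \<Rightarrow> (real \<Rightarrow> 'm) \<Rightarrow> real \<Rightarrow> real \<Rightarrow> bool" where
  "timelike_piece M \<gamma> s t \<longleftrightarrow>
     s < t \<and> C1_curve M \<gamma> {s..t} \<and> (\<forall>\<tau>\<in>{s..t}. velocity M \<gamma> {s..t} \<tau> \<in> future M (\<gamma> \<tau>))"

definition piece_rel :: "('m, 'e::euclidean_space) lorentz \<Rightarrow> ('m \<times> 'm) set" where
  "piece_rel M = {(\<gamma> s, \<gamma> t) |\<gamma> s t. timelike_piece M \<gamma> s t}"

lemma piece_relI: "timelike_piece M \<gamma> s t \<Longrightarrow> (\<gamma> s, \<gamma> t) \<in> piece_rel M"
  unfolding piece_rel_def by blast

text \<open>Chain rule with an affine inner map. The slope \<open>e\<close> is arbitrary: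
  \<open>e = 1\<close> covers restriction and translation, \<open>e = -1\<close> reversal. The new
  curve is prescribed only on \<open>{s..t}\<close>, so a curve defined by cases can be
  inserted.\<close>

lemma C1_curve_affine_reparam:
  fixes M :: "('m, 'e::euclidean_space) lorentz"
  assumes C1: "C1_curve M \<gamma> {a..b}" and "s < t"
    and into: "\<And>\<tau>. \<tau> \<in> {s..t} \<Longrightarrow> e * \<tau> + k \<in> {a..b}"
    and eq: "\<And>\<tau>. \<tau> \<in> {s..t} \<Longrightarrow> \<gamma>' \<tau> = \<gamma> (e * \<tau> + k)"
  shows "C1_curve M \<gamma>' {s..t}"
    and "\<And>\<tau>. \<tau> \<in> {s..t} \<Longrightarrow>
           velocity M \<gamma>' {s..t} \<tau> = (\<lambda>c. e *\<^sub>R velocity M \<gamma> {a..b} (e * \<tau> + k) c)"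
proof -
  define \<phi> where "\<phi> = (\<lambda>\<tau>. e * \<tau> + k)"
  have der: "(snd c \<circ> \<gamma>' has_vector_derivative e *\<^sub>R velocity M \<gamma> {a..b} (\<phi> \<tau>) c) (at \<tau> within {s..t})"
    if \<tau>: "\<tau> \<in> {s..t}" and c: "c \<in> charts_at M (\<gamma>' \<tau>)" for \<tau> c
  proof -
    have \<phi>\<tau>: "\<phi> \<tau> \<in> {a..b}" "\<gamma>' \<tau> = \<gamma> (\<phi> \<tau>)"
      using into[OF \<tau>] eq[OF \<tau>] by (auto simp: \<phi>_def)
    then have "(snd c \<circ> \<gamma>) differentiable (at (\<phi> \<tau>) within {a..b})"
      using C1 c by (auto simp: C1_curve_def charts_at_def)
    then have "(snd c \<circ> \<gamma> has_vector_derivative velocity M \<gamma> {a..b} (\<phi> \<tau>) c) (at (\<phi> \<tau>) within {a..b})"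
      using c \<phi>\<tau> by (simp add: velocity_def vector_derivative_works)
    then have "(snd c \<circ> \<gamma> has_vector_derivative velocity M \<gamma> {a..b} (\<phi> \<tau>) c)
        (at (\<phi> \<tau>) within \<phi> ` {s..t})"
      by (rule has_vector_derivative_within_subset) (use into in \<open>auto simp: \<phi>_def\<close>)
    moreover have "(\<phi> has_vector_derivative e) (at \<tau> within {s..t})"
      unfolding \<phi>_def by (auto intro!: derivative_eq_intros)
    ultimately have "((snd c \<circ> \<gamma>) \<circ> \<phi> has_vector_derivative e *\<^sub>R velocity M \<gamma> {a..b} (\<phi> \<tau>) c)
        (at \<tau> within {s..t})"
      by (intro vector_diff_chain_within)
    then show ?thesis
      by (rule has_vector_derivative_transform[rotated 2]) (use \<tau> eq in \<open>auto simp: \<phi>_def\<close>)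
  qed
  show vel: "velocity M \<gamma>' {s..t} \<tau> = (\<lambda>c. e *\<^sub>R velocity M \<gamma> {a..b} (e * \<tau> + k) c)"
    if \<tau>: "\<tau> \<in> {s..t}" for \<tau>
  proof
    fix c
    show "velocity M \<gamma>' {s..t} \<tau> c = e *\<^sub>R velocity M \<gamma> {a..b} (e * \<tau> + k) c"
    proof (cases "c \<in> charts_at M (\<gamma>' \<tau>)")
      case True
      have "vector_derivative (snd c \<circ> \<gamma>') (at \<tau> within {s..t}) = e *\<^sub>R velocity M \<gamma> {a..b} (\<phi> \<tau>) c"
        using der[OF \<tau> True] \<tau> \<open>s < t\<close> by (intro vector_derivative_within_closed_interval) auto
      then show ?thesis using True by (simp add: velocity_def[of M \<gamma>'] \<phi>_def)
    next
      case False
      \<comment> \<open>Both sides take the default value \<open>0\<close> of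
        \<open>velocity\<close>, since the two curves are at the same point of the manifold.\<close>
      then show ?thesis using eq[OF \<tau>] by (simp add: velocity_def)
    qed
  qed
  have contphi: "continuous_on A \<phi>" for A
    unfolding \<phi>_def by (intro continuous_intros)
  have "continuous_map (top_of_set {s..t}) (topol M) (\<gamma> \<circ> \<phi>)"
  proof (rule continuous_map_compose)
    show "continuous_map (top_of_set {s..t}) (top_of_set {a..b}) \<phi>"
      using contphi into by (auto simp: \<phi>_def)
    show "continuous_map (top_of_set {a..b}) (topol M) \<gamma>"
      using C1 by (simp add: C1_curve_def)
  qed
  then have cont: "continuous_map (top_of_set {s..t}) (topol M) \<gamma>'"
    by (rule continuous_map_eq) (auto simp: \<phi>_def eq)
  have "continuous_on ({s..t} \<inter> \<gamma>' -` fst c) (\<lambda>t'. velocity M \<gamma>' {s..t} t' c)" if "c \<in> atlas M" for c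
  proof -
    have "continuous_on ({a..b} \<inter> \<gamma> -` fst c) (\<lambda>t. velocity M \<gamma> {a..b} t c)"
      using C1 that by (simp add: C1_curve_def)
    then have "continuous_on ({s..t} \<inter> \<gamma>' -` fst c) (\<lambda>\<tau>. velocity M \<gamma> {a..b} (\<phi> \<tau>) c)"
      by (rule continuous_on_compose2[OF _ contphi]) (use into eq in \<open>auto simp: \<phi>_def\<close>)
    then have "continuous_on ({s..t} \<inter> \<gamma>' -` fst c) (\<lambda>\<tau>. e *\<^sub>R velocity M \<gamma> {a..b} (\<phi> \<tau>) c)"
      by (intro continuous_intros)
    then show ?thesis
      by (rule continuous_on_eq) (auto simp: vel \<phi>_def)
  qed
  moreover have "(snd c \<circ> \<gamma>') differentiable (at \<tau> within {s..t})"
    if "c \<in> atlas M" "\<tau> \<in> {s..t} \<inter> \<gamma>' -` fst c" for c \<tau>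
    using der[of \<tau> c] that by (intro differentiableI_vector) (auto simp: charts_at_def)
  ultimately show "C1_curve M \<gamma>' {s..t}"
    using cont by (simp add: C1_curve_def)
qed

text \<open>Slope \<open>1\<close> leaves the velocities unchanged. The case \<open>k = 0\<close>
  restricts a piece to a subinterval; other values of \<open>k\<close> move a piece along the
  parameter line for concatenation.\<close>

lemma timelike_piece_shift:
  assumes "timelike_piece M \<gamma> a b" "s < t"
    and into: "\<And>\<tau>. \<tau> \<in> {s..t} \<Longrightarrow> \<tau> + k \<in> {a..b}"
    and eq: "\<And>\<tau>. \<tau> \<in> {s..t} \<Longrightarrow> \<gamma>' \<tau> = \<gamma> (\<tau> + k)"
  shows "timelike_piece M \<gamma>' s t"
proof -
  have "C1_curve M \<gamma> {a..b}"
    using assms by (simp add: timelike_piece_def)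
  from C1_curve_affine_reparam[OF this \<open>s < t\<close>, of 1 k \<gamma>'] show ?thesis
    using assms by (simp add: timelike_piece_def)
qed

section \<open>Timelike curves as finite chains of pieces\<close>

lemma future_timelike_curve_iff:
  "future_timelike_curve M \<gamma> a b \<longleftrightarrow>
     a < b \<and> continuous_map (top_of_set {a..b}) (topol M) \<gamma> \<and>
     (\<exists>S. finite S \<and> {a, b} \<subseteq> S \<and> S \<subseteq> {a..b} \<and>
        (\<forall>s\<in>S. \<forall>t\<in>S. s < t \<and> S \<inter> {s<..<t} = {} \<longrightarrow> timelike_piece M \<gamma> s t))"
  by (simp add: future_timelike_curve_def timelike_piece_def)

text \<open>Each pair of consecutive break points contributes one step of \<open>piece_rel\<close>.
  The chain from \<open>a\<close> to a break point \<open>s\<close> is built by induction on the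
  number of break points before \<open>s\<close>.\<close>

lemma future_timelike_curveD:
  assumes "future_timelike_curve M \<gamma> a b"
  shows "(\<gamma> a, \<gamma> b) \<in> (piece_rel M)\<^sup>+"
proof -
  from assms obtain S where S: "finite S" "{a, b} \<subseteq> S" "S \<subseteq> {a..b}"
    and piece: "\<forall>s\<in>S. \<forall>t\<in>S. s < t \<and> S \<inter> {s<..<t} = {} \<longrightarrow> timelike_piece M \<gamma> s t"
    and "a < b" and cont: "continuous_map (top_of_set {a..b}) (topol M) \<gamma>"
    unfolding future_timelike_curve_iff by (elim conjE exE) (rule that)
  note S = S \<open>a < b\<close>
  have "(\<gamma> a, \<gamma> s) \<in> (piece_rel M)\<^sup>+" if "s \<in> S" "a < s" for s
    using that
  proof (induction "card {x \<in> S. x < s}" arbitrary: s rule: less_induct)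
    case less
    \<comment> \<open>The break point immediately before \<open>s\<close>: nothing of
      \<open>S\<close> lies strictly between, so the condition on pieces applies to
      \<open>{s'..s}\<close>.\<close>
    define s' where "s' = Max {x \<in> S. x < s}"
    have fin: "finite {x \<in> S. x < s}" and ne: "{x \<in> S. x < s} \<noteq> {}"
      using S less by auto
    then have s': "s' \<in> S" "s' < s"
      using Max_in[OF fin ne] by (auto simp: s'_def)
    have max: "x \<le> s'" if "x \<in> S" "x < s" for x
      unfolding s'_def using fin that by (intro Max_ge) auto
    have "S \<inter> {s'<..<s} = {}"
      using max by fastforce
    then have step: "(\<gamma> s', \<gamma> s) \<in> piece_rel M"
      using s' less piece piece_relI by blast
    show ?case
    proof (cases "s' = a")
      case False
      then have "a < s'"
        using s' S by force
      have "{x \<in> S. x < s'} \<subset> {x \<in> S. x < s}"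
        using s' by auto
      then have "card {x \<in> S. x < s'} < card {x \<in> S. x < s}"
        using fin by (rule psubset_card_mono[rotated])
      with less(1) s' \<open>a < s'\<close> have "(\<gamma> a, \<gamma> s') \<in> (piece_rel M)\<^sup>+"
        by blast
      then show ?thesis using step by (rule trancl_into_trancl)
    qed (use step in auto)
  qed
  then show ?thesis using S by auto
qed

lemma timelike_piece_imp_curve:
  assumes "timelike_piece M \<gamma> s t"
  shows "future_timelike_curve M \<gamma> s t"
proof -
  have st: "s < t" using assms by (simp add: timelike_piece_def)
  show ?thesis
    unfolding future_timelike_curve_iff
  proof (intro conjI exI)
    show "continuous_map (top_of_set {s..t}) (topol M) \<gamma>"
      using assms by (simp add: timelike_piece_def C1_curve_def)
    show "\<forall>s'\<in>{s, t}. \<forall>t'\<in>{s, t}. s' < t' \<and> {s, t} \<inter> {s'<..<t'} = {} \<longrightarrow> timelike_piece M \<gamma> s' t'"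
      using assms st by auto
  qed (use st in auto)
qed

text \<open>The piece is translated to start at parameter \<open>b\<close> and glued on. The
  velocity may jump at \<open>b\<close>, which is already a break point; the only new break point is
  the end \<open>d\<close>.\<close>

lemma future_timelike_curve_append:
  assumes \<gamma>: "future_timelike_curve M \<gamma> a b" and \<delta>: "timelike_piece M \<delta> s t" and [simp]: "\<delta> s = \<gamma> b"
  shows "\<exists>\<gamma>' d. future_timelike_curve M \<gamma>' a d \<and> \<gamma>' a = \<gamma> a \<and> \<gamma>' d = \<delta> t"
proof -
  from \<gamma> obtain S where S: "finite S" "{a, b} \<subseteq> S" "S \<subseteq> {a..b}"
    and piece: "\<forall>s\<in>S. \<forall>t\<in>S. s < t \<and> S \<inter> {s<..<t} = {} \<longrightarrow> timelike_piece M \<gamma> s t"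
    and "a < b" and cont: "continuous_map (top_of_set {a..b}) (topol M) \<gamma>"
    unfolding future_timelike_curve_iff by (elim conjE exE) (rule that)
  note S = S \<open>a < b\<close>
  have st: "s < t" and cont\<delta>: "continuous_map (top_of_set {s..t}) (topol M) \<delta>"
    using \<delta> by (auto simp: timelike_piece_def C1_curve_def)
  define d where "d = b + (t - s)"
  define \<gamma>' where "\<gamma>' = (\<lambda>\<tau>. if \<tau> \<le> b then \<gamma> \<tau> else \<delta> (\<tau> + (s - b)))"
  have bd: "b < d" using st by (simp add: d_def)
  have c: "continuous_map (top_of_set {a..d}) (topol M) \<gamma>'"
    unfolding \<gamma>'_def
  proof (rule continuous_map_cases_le)
    show "continuous_map (subtopology (top_of_set {a..d}) {x \<in> topspace (top_of_set {a..d}). x \<le> b})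
        (topol M) \<gamma>"
      unfolding subtopology_subtopology
      by (rule continuous_map_from_subtopology_mono[OF cont]) auto
    have "continuous_map (top_of_set {b..d}) (topol M) (\<delta> \<circ> (\<lambda>\<tau>. \<tau> + (s - b)))"
      by (rule continuous_map_compose[OF _ cont\<delta>]) (auto intro!: continuous_intros simp: d_def)
    then show "continuous_map (subtopology (top_of_set {a..d}) {x \<in> topspace (top_of_set {a..d}). b \<le> x})
        (topol M) (\<lambda>\<tau>. \<delta> (\<tau> + (s - b)))"
      unfolding subtopology_subtopology o_def
      by (rule continuous_map_from_subtopology_mono) auto
  qed (auto simp: continuous_map_iff_continuous)
  \<comment> \<open>As \<open>b\<close> is the largest element of \<open>S\<close>, two consecutive
    points of \<open>insert d S\<close> are either consecutive in \<open>S\<close> or are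
    \<open>b\<close> and \<open>d\<close>.\<close>
  have p: "timelike_piece M \<gamma>' s' t'"
    if "s' \<in> insert d S" "t' \<in> insert d S" "s' < t'" "insert d S \<inter> {s'<..<t'} = {}" for s' t'
  proof (cases "t' \<in> S")
    case True
    then have "s' \<in> S" using that S bd by fastforce
    then have "timelike_piece M \<gamma> s' t'" using piece that True by auto
    then show ?thesis
      by (rule timelike_piece_shift[where k = 0]) (use S True that in \<open>auto simp: \<gamma>'_def\<close>)
  next
    case False
    then have t': "t' = d" and "s' \<in> S" using that by auto
    moreover have "b \<notin> {s'<..<t'}" using that S by blast
    ultimately have [simp]: "s' = b" using S bd by force
    \<comment> \<open>At the parameter \<open>b\<close> itself \<open>\<gamma>'\<close> takes the
      branch \<open>\<gamma> b\<close>; it agrees with the translated piece because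
      \<open>\<delta> s = \<gamma> b\<close>.\<close>
    show ?thesis
      by (rule timelike_piece_shift[OF \<delta>, where k = "s - b"])
        (use t' bd st in \<open>auto simp: \<gamma>'_def d_def\<close>)
  qed
  have "future_timelike_curve M \<gamma>' a d"
    unfolding future_timelike_curve_iff
    using c S bd p by (intro conjI exI[of _ "insert d S"]) auto
  moreover have "\<gamma>' a = \<gamma> a" "\<gamma>' d = \<delta> t"
    using S bd by (auto simp: \<gamma>'_def d_def)
  ultimately show ?thesis by blast
qed

text \<open>Reduces questions on chronology to single \<open>C1\<close> pieces: transitivity is
  built in, and openness and time reversal can be studied on \<open>piece_rel\<close>.\<close>

lemma chron_rel_eq_trancl: "chron_rel M = (piece_rel M)\<^sup>+"
proof
  show "chron_rel M \<subseteq> (piece_rel M)\<^sup>+"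
    unfolding chron_rel_def using future_timelike_curveD by auto
  have "(p, q) \<in> chron_rel M" if "(p, q) \<in> (piece_rel M)\<^sup>+" for p q
    using that
  proof induction
    case (base y)
    then show ?case
      unfolding piece_rel_def chron_rel_def using timelike_piece_imp_curve by fastforce
  next
    case (step y z)
    then show ?case
      unfolding piece_rel_def chron_rel_def using future_timelike_curve_append by fastforce
  qed
  then show "(piece_rel M)\<^sup>+ \<subseteq> chron_rel M" by auto
qed

lemma chron_rel_trans: "(p, q) \<in> chron_rel M \<Longrightarrow> (q, x) \<in> chron_rel M \<Longrightarrow> (p, x) \<in> chron_rel M"
  by (simp add: chron_rel_eq_trancl)

lemma chron_rel_subset: "chron_rel M \<subseteq> points M \<times> points M"
  unfolding chron_rel_def future_timelike_curve_def continuous_map_def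
  by (auto simp: Pi_iff)

section \<open>Coordinates on a spacetime\<close>

text \<open>The bundle of future cones over the chart domain, written in coordinates so that its
  openness is openness in a product of Euclidean spaces.\<close>

definition cone_bundle ::
    "('m, 'e::euclidean_space) lorentz \<Rightarrow> ('m, 'e) chart \<Rightarrow> ('e \<times> 'e) set" where
  "cone_bundle M c =
     {(x, u). x \<in> snd c ` fst c \<and> tangent_of M (param c x) c u \<in> future M (param c x)}"

text \<open>Expanding \<open>v t\<close> in the finite basis turns continuity for each fixed vector
  into continuity along a varying vector. The metric coefficients and the derivatives of transition
  maps are known to be continuous only for fixed vectors.\<close>

lemma continuous_on_linear_family:
  fixes D :: "'a::topological_space \<Rightarrow> 'e::euclidean_space \<Rightarrow> 'b::real_normed_vector"
  assumes "\<And>v. continuous_on T (\<lambda>t. D t v)" "\<And>t. t \<in> T \<Longrightarrow> linear (D t)" "continuous_on T v"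
  shows "continuous_on T (\<lambda>t. D t (v t))"
proof -
  have cont: "continuous_on T (\<lambda>t. \<Sum>i\<in>Basis. (v t \<bullet> i) *\<^sub>R D t i)"
    using assms by (intro continuous_intros)
  have "D t (v t) = (\<Sum>i\<in>Basis. (v t \<bullet> i) *\<^sub>R D t i)" if "t \<in> T" for t
  proof -
    interpret linear "D t" using assms that by blast
    have "D t (v t) = D t (\<Sum>i\<in>Basis. (v t \<bullet> i) *\<^sub>R i)"
      by (simp add: euclidean_representation)
    then show ?thesis by (simp add: sum scale)
  qed
  then show ?thesis
    by (rule continuous_on_cong[THEN iffD2, OF refl _ cont])
qed

locale spacetime_manifold =
  fixes r :: enat and M :: "('m, 'e::euclidean_space) lorentz"
  assumes spacetime: "spacetime r M"
begin

section \<open>Charts and their inverses\<close>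

lemma manifold: "Cr_manifold r M"
  using spacetime by (simp add: spacetime_def)

lemma openin_chart: "c \<in> atlas M \<Longrightarrow> openin (topol M) (fst c)"
  using manifold by (simp add: Cr_manifold_def)

lemma open_chart_image: "c \<in> atlas M \<Longrightarrow> open (snd c ` fst c)"
  using manifold by (simp add: Cr_manifold_def)

lemma obtain_chart:
  assumes "p \<in> points M"
  obtains c where "c \<in> atlas M" "p \<in> fst c" "c \<in> charts_at M p"
  using assms manifold unfolding Cr_manifold_def charts_at_def by blast

lemma chart_homeomorphic:
  "c \<in> atlas M \<Longrightarrow>
    homeomorphic_map (subtopology (topol M) (fst c)) (top_of_set (snd c ` fst c)) (snd c)"
  using manifold by (simp add: Cr_manifold_def)

lemma topspace_chart: "c \<in> atlas M \<Longrightarrow> topspace (subtopology (topol M) (fst c)) = fst c"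
  by (meson openin_chart openin_subset topspace_subtopology_subset)

lemma chart_subset_points: "c \<in> atlas M \<Longrightarrow> fst c \<subseteq> points M"
  by (simp add: openin_chart openin_subset)

lemma inj_on_chart: "c \<in> atlas M \<Longrightarrow> inj_on (snd c) (fst c)"
  using chart_homeomorphic homeomorphic_imp_injective_map topspace_chart by metis

lemma param_chart [simp]: "c \<in> atlas M \<Longrightarrow> p \<in> fst c \<Longrightarrow> param c (snd c p) = p"
  by (simp add: param_def inj_on_chart)

lemma chart_param [simp]: "x \<in> snd c ` fst c \<Longrightarrow> snd c (param c x) = x"
  by (simp add: param_def f_inv_into_f)

lemma param_in_chart [simp]: "x \<in> snd c ` fst c \<Longrightarrow> param c x \<in> fst c"
  by (simp add: param_def inv_into_into)

text \<open>On the coordinate image \<open>param c\<close> agrees with the continuous inverse that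
  the homeomorphism provides.\<close>

lemma continuous_map_param:
  assumes "c \<in> atlas M"
  shows "continuous_map (top_of_set (snd c ` fst c)) (topol M) (param c)"
proof -
  obtain g where g: "homeomorphic_maps (subtopology (topol M) (fst c)) (top_of_set (snd c ` fst c)) (snd c) g"
    using chart_homeomorphic[OF assms] homeomorphic_map_maps by blast
  have "continuous_map (top_of_set (snd c ` fst c)) (subtopology (topol M) (fst c)) (param c)"
  proof (rule continuous_map_eq)
    show "continuous_map (top_of_set (snd c ` fst c)) (subtopology (topol M) (fst c)) g"
      using g by (simp add: homeomorphic_maps_def)
    show "g y = param c y" if "y \<in> topspace (top_of_set (snd c ` fst c))" for y
      using g that assms by (auto simp: homeomorphic_maps_def topspace_chart simp del: topspace_subtopology)
  qed
  then show ?thesis by (simp add: continuous_map_in_subtopology)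
qed

lemma open_chart_image_openin:
  assumes "c \<in> atlas M" "openin (topol M) U"
  shows "open (snd c ` (fst c \<inter> U))"
proof -
  have "openin (subtopology (topol M) (fst c)) (fst c \<inter> U)"
    using assms by (simp add: openin_subtopology_Int2)
  then have "openin (top_of_set (snd c ` fst c)) (snd c ` (fst c \<inter> U))"
    using chart_homeomorphic[OF assms(1)] homeomorphic_imp_open_map open_map_def by blast
  then show ?thesis
    using open_chart_image[OF assms(1)] openin_open_eq by blast
qed

lemma openin_chart_vimage:
  assumes "c \<in> atlas M" "open B"
  shows "openin (topol M) {p \<in> fst c. snd c p \<in> B}"
proof -
  have "continuous_map (subtopology (topol M) (fst c)) euclidean (snd c)"
    using chart_homeomorphic[OF assms(1)] homeomorphic_imp_continuous_map continuous_map_in_subtopology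
    by blast
  from openin_continuous_map_preimage[OF this, of B]
  have "openin (subtopology (topol M) (fst c)) {p \<in> fst c. snd c p \<in> B}"
    using assms by (simp add: topspace_chart del: topspace_subtopology)
  then show ?thesis
    using openin_chart[OF assms(1)] openin_trans_full by blast
qed

subsection \<open>Transition maps and tangent vectors\<close>

lemma open_overlap: "c \<in> atlas M \<Longrightarrow> d \<in> atlas M \<Longrightarrow> open (snd c ` (fst c \<inter> fst d))"
  using open_chart_image_openin openin_chart by blast

lemma transition_C1:
  assumes "c \<in> atlas M" "d \<in> atlas M"
  shows "Ck_on (Suc 0) (transition c d) (snd c ` (fst c \<inter> fst d))"
proof -
  have "3 \<le> r" using spacetime by (simp add: spacetime_def)
  then have "enat (Suc 0) \<le> r"
    by (metis One_nat_def dual_order.trans numeral_eq_enat enat_ord_simps(1) one_le_numeral)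
  then show ?thesis
    using manifold assms unfolding Cr_manifold_def C_on_def by blast
qed

lemma transition_has_derivative:
  assumes "c \<in> charts_at M p" "d \<in> charts_at M p"
  shows "(transition c d has_derivative frechet_derivative (transition c d) (at (snd c p))) (at (snd c p))"
  using transition_C1[of c d] assms by (auto simp: charts_at_def frechet_derivative_works)

lemma transition_chart [simp]: "c \<in> atlas M \<Longrightarrow> p \<in> fst c \<Longrightarrow> transition c d (snd c p) = snd d p"
  by (simp add: transition_def)

text \<open>The cocycle identity of the tangent bundle: the chain rule, since
  \<open>transition d e \<circ> transition c d\<close> agrees with \<open>transition c e\<close> on
  the open coordinate image of the overlap of \<open>c\<close> and \<open>d\<close>.\<close>

lemma transition_derivative_compose:
  assumes c: "c \<in> charts_at M p" and d: "d \<in> charts_at M p" and e: "e \<in> charts_at M p"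
  shows "frechet_derivative (transition d e) (at (snd d p))
           (frechet_derivative (transition c d) (at (snd c p)) u) =
         frechet_derivative (transition c e) (at (snd c p)) u"
proof -
  have atl: "c \<in> atlas M" "d \<in> atlas M" "e \<in> atlas M" "p \<in> fst c" "p \<in> fst d" "p \<in> fst e"
    using assms by (auto simp: charts_at_def)
  have "(transition d e has_derivative frechet_derivative (transition d e) (at (snd d p)))
      (at (transition c d (snd c p)))"
    using transition_has_derivative[OF d e] atl by simp
  from diff_chain_at[OF transition_has_derivative[OF c d] this]
  have "(transition d e \<circ> transition c d has_derivative
      frechet_derivative (transition d e) (at (snd d p)) \<circ> frechet_derivative (transition c d) (at (snd c p)))
      (at (snd c p))" .
  then have "(transition c e has_derivative
      frechet_derivative (transition d e) (at (snd d p)) \<circ> frechet_derivative (transition c d) (at (snd c p)))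
      (at (snd c p))"
  proof (rule has_derivative_transform_within_open)
    show "open (snd c ` (fst c \<inter> fst d))" using open_overlap atl by blast
    show "snd c p \<in> snd c ` (fst c \<inter> fst d)" using atl by blast
    show "(transition d e \<circ> transition c d) x = transition c e x" if "x \<in> snd c ` (fst c \<inter> fst d)" for x
      using that atl by (auto simp: transition_def)
  qed
  from frechet_derivative_at[OF this] show ?thesis
    by (metis comp_apply)
qed

lemma linear_transition_derivative:
  "c \<in> charts_at M p \<Longrightarrow> d \<in> charts_at M p \<Longrightarrow> linear (frechet_derivative (transition c d) (at (snd c p)))"
  using has_derivative_linear transition_has_derivative by blast

text \<open>\<open>transition c c\<close> is the identity on the open coordinate image, a
  neighbourhood of \<open>snd c p\<close>; elsewhere its values are arbitrary.\<close>

lemma transition_self_derivative: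
  assumes "c \<in> charts_at M p"
  shows "frechet_derivative (transition c c) (at (snd c p)) u = u"
proof -
  have atl: "c \<in> atlas M" "p \<in> fst c" using assms by (auto simp: charts_at_def)
  have "(transition c c has_derivative id) (at (snd c p))"
    by (rule has_derivative_transform_within_open[OF has_derivative_id open_chart_image[OF atl(1)]])
      (use atl in auto)
  then show ?thesis
    using frechet_derivative_at by (metis id_apply)
qed

lemma tangent_of_chart: "c \<in> charts_at M p \<Longrightarrow> tangent_of M p c u c = u"
  by (simp add: tangent_of_def transition_self_derivative)

text \<open>The transformation law between two charts is the cocycle identity starting from
  \<open>c\<close>.\<close>

lemma tangent_of_in_tangent_space: "c \<in> charts_at M p \<Longrightarrow> tangent_of M p c u \<in> tangent_space M p"
  by (auto simp: tangent_space_def tangent_of_def transition_derivative_compose)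

lemma tangent_spaceD:
  assumes "v \<in> tangent_space M p" "c \<in> charts_at M p"
  shows "v d = (if d \<in> charts_at M p
    then frechet_derivative (transition c d) (at (snd c p)) (v c) else 0)"
proof (cases "d \<in> charts_at M p")
  case True
  have "v d = frechet_derivative (transition c d) (at (snd c p)) (v c)"
    using assms True unfolding tangent_space_def by blast
  with True show ?thesis by presburger
next
  case False
  have "v d = 0"
    using assms False unfolding tangent_space_def by blast
  with False show ?thesis by presburger
qed

text \<open>With \<open>tangent_of_chart\<close>, evaluation at \<open>c\<close> and
  \<open>tangent_of M p c\<close> are mutually inverse, so each chart around \<open>p\<close>
  identifies the tangent space with \<open>'e\<close>.\<close>

lemma tangent_of_component:
  assumes "v \<in> tangent_space M p" "c \<in> charts_at M p"
  shows "tangent_of M p c (v c) = v"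
  unfolding tangent_of_def by (rule ext) (rule tangent_spaceD[OF assms, symmetric])

lemma uminus_tangent_space:
  assumes v: "v \<in> tangent_space M p" shows "- v \<in> tangent_space M p"
  unfolding tangent_space_def
proof (intro CollectI conjI ballI allI impI)
  fix c d assume cd: "c \<in> charts_at M p" "d \<in> charts_at M p"
  have "frechet_derivative (transition c d) (at (snd c p)) (- v c) =
      - frechet_derivative (transition c d) (at (snd c p)) (v c)"
    using linear_transition_derivative[OF cd] by (rule linear_neg)
  then show "(- v) d = frechet_derivative (transition c d) (at (snd c p)) ((- v) c)"
    using tangent_spaceD[OF v cd(1), of d] cd(2) by (simp only: fun_Compl_def if_True)
next
  fix c assume "c \<notin> charts_at M p"
  then have "v c = 0" using v unfolding tangent_space_def by blast
  then show "(- v) c = 0" by simp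
qed

section \<open>The metric in coordinates\<close>

lemma metric_eq_metric_in:
  assumes "c \<in> charts_at M p" "v \<in> tangent_space M p" "w \<in> tangent_space M p"
  shows "metric M p v w = metric_in M c (snd c p) (v c) (w c)"
proof -
  have "param c (snd c p) = p" using assms by (auto simp: charts_at_def)
  then show ?thesis
    using assms by (simp add: metric_in_def tangent_of_component)
qed

lemma bilinear_metric_in: "c \<in> atlas M \<Longrightarrow> x \<in> snd c ` fst c \<Longrightarrow> bilinear (metric_in M c x)"
  using spacetime unfolding spacetime_def lorentzian_metric_def lorentzian_form_def by blast

text \<open>Bilinearity is part of the definition only for the coordinate expressions
  \<open>metric_in\<close>, so the sign rules are read off in a chart around
  \<open>p\<close>.\<close>

lemma metric_uminus:
  assumes "p \<in> points M" "v \<in> tangent_space M p" "w \<in> tangent_space M p"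
  shows "metric M p (- v) w = - metric M p v w" "metric M p v (- w) = - metric M p v w"
proof -
  obtain c where c: "c \<in> atlas M" "p \<in> fst c" "c \<in> charts_at M p"
    by (rule obtain_chart[OF assms(1)])
  have "bilinear (metric_in M c (snd c p))"
    by (intro bilinear_metric_in imageI c)
  then show "metric M p (- v) w = - metric M p v w" "metric M p v (- w) = - metric M p v w"
    using assms c by (simp_all add: metric_eq_metric_in uminus_tangent_space bilinear_lneg bilinear_rneg)
qed

lemma continuous_on_metric_in:
  assumes "c \<in> atlas M"
  shows "continuous_on (snd c ` fst c) (\<lambda>x. metric_in M c x u w)"
proof -
  have "C_on (r - 1) (\<lambda>x. metric_in M c x u w) (snd c ` fst c)"
    using spacetime assms by (simp add: spacetime_def lorentzian_metric_def)
  then have "Ck_on 0 (\<lambda>x. metric_in M c x u w) (snd c ` fst c)"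
    by (metis C_on_def i0_lb zero_enat_def)
  then show ?thesis by simp
qed

text \<open>\<open>continuous_on_linear_family\<close> is applied twice, once for each argument of
  the bilinear form.\<close>

lemma continuous_on_metric_in_fields:
  assumes c: "c \<in> atlas M" and f: "continuous_on T f" "f ` T \<subseteq> snd c ` fst c"
    and u: "continuous_on T u" and w: "continuous_on T w"
  shows "continuous_on T (\<lambda>t. metric_in M c (f t) (u t) (w t))"
proof (rule continuous_on_linear_family[of T "\<lambda>t. metric_in M c (f t) (u t)" w])
  have bil: "bilinear (metric_in M c (f t))" if "t \<in> T" for t
    by (rule bilinear_metric_in) (use c f that in auto)
  show "continuous_on T w" by fact
  show "linear (metric_in M c (f t) (u t))" if "t \<in> T" for t
    using bil[OF that] by (simp add: bilinear_def)
  show "continuous_on T (\<lambda>t. metric_in M c (f t) (u t) v)" for v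
  proof (rule continuous_on_linear_family[of T "\<lambda>t a. metric_in M c (f t) a v"])
    show "continuous_on T (\<lambda>t. metric_in M c (f t) a v)" for a
      by (rule continuous_on_compose2[OF continuous_on_metric_in[OF c] f])
    show "linear (\<lambda>a. metric_in M c (f t) a v)" if "t \<in> T" for t
      using bil[OF that] by (simp add: bilinear_def)
  qed fact
qed

subsection \<open>The bundle of future cones\<close>

lemma obtain_orientation:
  assumes "p \<in> points M"
  obtains U X where "openin (topol M) U" "p \<in> U"
    "\<forall>q\<in>U. X q \<in> timelike_vectors M q"
    "\<forall>c\<in>atlas M. continuous_map (subtopology (topol M) (U \<inter> fst c)) euclidean (\<lambda>q. X q c)"
    "\<forall>q\<in>U. future M q = {v \<in> timelike_vectors M q. metric M q (X q) v < 0}"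
proof -
  have "time_orientation M"
    using spacetime by (simp add: spacetime_def)
  from this[unfolded time_orientation_def, THEN bspec, OF assms] show ?thesis
    by (elim exE conjE) (rule that)
qed

lemma future_timelike: "p \<in> points M \<Longrightarrow> v \<in> future M p \<Longrightarrow> v \<in> timelike_vectors M p"
  by (erule obtain_orientation) blast

text \<open>The local orienting field is itself future-directed, being timelike.\<close>

lemma future_nonempty: "p \<in> points M \<Longrightarrow> future M p \<noteq> {}"
  by (erule obtain_orientation) (auto simp: timelike_vectors_def)

lemma future_component_in_cone_bundle:
  assumes "c \<in> atlas M" "p \<in> fst c" "v \<in> future M p"
  shows "(snd c p, v c) \<in> cone_bundle M c"
proof -
  have "p \<in> points M" using assms chart_subset_points by blast
  then have "v \<in> tangent_space M p"
    using future_timelike assms by (auto simp: timelike_vectors_def)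
  then show ?thesis
    using assms by (simp add: cone_bundle_def tangent_of_component charts_at_def)
qed

text \<open>Locally the future cone is cut out by two strict inequalities: the metric is negative on
  \<open>(u, u)\<close> and on \<open>(X, u)\<close>, where \<open>X\<close> is a continuous
  orienting field. In coordinates both expressions are continuous in the point and the vector
  jointly.\<close>

lemma open_cone_bundle:
  assumes c: "c \<in> atlas M"
  shows "open (cone_bundle M c)"
proof (subst open_subopen, intro ballI)
  fix z assume "z \<in> cone_bundle M c"
  then obtain x0 u0 where z: "z = (x0, u0)" and x0: "x0 \<in> snd c ` fst c"
    and u0: "tangent_of M (param c x0) c u0 \<in> future M (param c x0)"
    by (auto simp: cone_bundle_def)
  have "param c x0 \<in> points M"
    using chart_subset_points[OF c] param_in_chart[OF x0] by (rule subsetD)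
  then obtain U X where U: "openin (topol M) U" "param c x0 \<in> U"
    and X: "\<forall>q\<in>U. X q \<in> timelike_vectors M q"
    and contX: "\<forall>d\<in>atlas M.
      continuous_map (subtopology (topol M) (U \<inter> fst d)) euclidean (\<lambda>q. X q d)"
    and fut: "\<forall>q\<in>U. future M q = {v \<in> timelike_vectors M q. metric M q (X q) v < 0}"
    by (rule obtain_orientation)
  note X = X[rule_format] and contX = contX[rule_format] and fut = fut[rule_format]
  define W where "W = snd c ` (fst c \<inter> U)"
  have W: "open W" "W \<subseteq> snd c ` fst c"
    using open_chart_image_openin[OF c U(1)] by (auto simp: W_def)
  have pW: "param c x \<in> U \<inter> fst c" if "x \<in> W" for x
    using that c by (auto simp: W_def)
  have "continuous_map (top_of_set W) (topol M) (param c)"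
    using continuous_map_from_subtopology_mono[OF continuous_map_param[OF c] W(2)] .
  then have "continuous_map (top_of_set W) (subtopology (topol M) (U \<inter> fst c)) (param c)"
    using pW by (auto simp: continuous_map_in_subtopology)
  from continuous_map_compose[OF this contX[OF c]]
  have contXW: "continuous_on W (\<lambda>x. X (param c x) c)"
    by (simp add: o_def)
  have contXW': "continuous_on (W \<times> UNIV) (\<lambda>z. X (param c (fst z)) c)"
    by (rule continuous_on_compose2[OF contXW]) (auto intro: continuous_intros)
  define f where "f = (\<lambda>z. metric_in M c (fst z) (snd z) (snd z))"
  define g where "g = (\<lambda>z. metric_in M c (fst z) (X (param c (fst z)) c) (snd z))"
  have "continuous_on (W \<times> UNIV) f" "continuous_on (W \<times> UNIV) g"
    unfolding f_def g_def
    using W by (auto intro!: continuous_on_metric_in_fields[OF c] contXW' continuous_intros)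
  then have "open ((W \<times> UNIV) \<inter> f -` {..<0})" "open ((W \<times> UNIV) \<inter> g -` {..<0})"
    using W by (auto intro!: continuous_open_preimage open_Times)
  then have "open (((W \<times> UNIV) \<inter> f -` {..<0}) \<inter> ((W \<times> UNIV) \<inter> g -` {..<0}))"
    by (rule open_Int)
  also have "((W \<times> UNIV) \<inter> f -` {..<0}) \<inter> ((W \<times> UNIV) \<inter> g -` {..<0}) = cone_bundle M c \<inter> (W \<times> UNIV)"
  proof -
    \<comment> \<open>The two conditions that define \<open>future\<close> through the orienting
      field, read in the chart \<open>c\<close>, are the negativity of \<open>f\<close> and of
      \<open>g\<close>.\<close>
    have "tangent_of M (param c x) c u \<in> future M (param c x) \<longleftrightarrow> f (x, u) < 0 \<and> g (x, u) < 0"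
      if x: "x \<in> W" for x u
    proof -
      define p where "p = param c x"
      have p: "p \<in> U" "p \<in> fst c" "c \<in> charts_at M p" "snd c p = x"
        using pW[OF x] x W c by (auto simp: p_def charts_at_def)
      have "X p \<in> tangent_space M p" "tangent_of M p c u \<in> tangent_space M p"
        using X[OF p(1)] tangent_of_in_tangent_space[OF p(3)] by (auto simp: timelike_vectors_def)
      then show ?thesis
        unfolding p_def[symmetric] fut[OF p(1)]
        using p by (simp add: f_def g_def timelike_vectors_def metric_eq_metric_in[OF p(3)]
            tangent_of_chart p_def[symmetric])
    qed
    then show ?thesis
      using W by (auto simp: cone_bundle_def)
  qed
  finally have "open (cone_bundle M c \<inter> (W \<times> UNIV))" .
  moreover have "z \<in> cone_bundle M c \<inter> (W \<times> UNIV)"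
  proof -
    have "x0 \<in> W" unfolding W_def
      using U(2) x0 by (metis IntI chart_param image_eqI param_in_chart)
    then show ?thesis using \<open>z \<in> cone_bundle M c\<close> z by auto
  qed
  ultimately show "\<exists>T. open T \<and> z \<in> T \<and> T \<subseteq> cone_bundle M c" by blast
qed

text \<open>Allows curves to be constructed in the coordinates of a single chart. In every other
  chart the velocity is obtained by the chain rule, and its continuity from that of the derivative
  of the transition map.\<close>

lemma timelike_piece_in_chart:
  assumes c: "c \<in> atlas M" and "s < t"
    and \<beta>: "\<And>\<tau>. \<tau> \<in> {s..t} \<Longrightarrow> (\<beta> has_vector_derivative \<beta>' \<tau>) (at \<tau> within {s..t})"
    and \<beta>': "continuous_on {s..t} \<beta>'"
    and cone: "\<And>\<tau>. \<tau> \<in> {s..t} \<Longrightarrow> (\<beta> \<tau>, \<beta>' \<tau>) \<in> cone_bundle M c"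
  shows "timelike_piece M (param c \<circ> \<beta>) s t"
proof -
  define \<gamma> where "\<gamma> = param c \<circ> \<beta>"
  have in_c: "\<beta> \<tau> \<in> snd c ` fst c" if "\<tau> \<in> {s..t}" for \<tau>
    using cone[OF that] by (simp add: cone_bundle_def)
  have chart: "c \<in> charts_at M (\<gamma> \<tau>)" "snd c (\<gamma> \<tau>) = \<beta> \<tau>" if "\<tau> \<in> {s..t}" for \<tau>
    using in_c[OF that] c by (auto simp: \<gamma>_def charts_at_def)
  have cont\<beta>: "continuous_on {s..t} \<beta>"
    using \<beta> has_vector_derivative_continuous continuous_on_eq_continuous_within by blast
  have der: "(snd d \<circ> \<gamma> has_vector_derivative frechet_derivative (transition c d) (at (\<beta> \<tau>)) (\<beta>' \<tau>))
      (at \<tau> within {s..t})" if \<tau>: "\<tau> \<in> {s..t}" and d: "d \<in> charts_at M (\<gamma> \<tau>)" for \<tau> d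
  proof -
    have "(transition c d has_derivative frechet_derivative (transition c d) (at (\<beta> \<tau>))) (at (\<beta> \<tau>))"
      using transition_has_derivative[OF chart(1)[OF \<tau>] d] chart(2)[OF \<tau>] by simp
    then have "(transition c d has_derivative frechet_derivative (transition c d) (at (\<beta> \<tau>)))
        (at (\<beta> \<tau>) within \<beta> ` {s..t})"
      by (rule has_derivative_at_withinI)
    from vector_derivative_diff_chain_within[OF \<beta>[OF \<tau>] this] show ?thesis
      unfolding \<gamma>_def transition_def o_assoc .
  qed
  \<comment> \<open>The components just computed obey the transformation law, so the velocity is the
    tangent vector with component \<open>\<beta>' \<tau>\<close> in \<open>c\<close>.\<close>
  have vel: "velocity M \<gamma> {s..t} \<tau> = tangent_of M (\<gamma> \<tau>) c (\<beta>' \<tau>)" if \<tau>: "\<tau> \<in> {s..t}" for \<tau>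
  proof
    fix d
    show "velocity M \<gamma> {s..t} \<tau> d = tangent_of M (\<gamma> \<tau>) c (\<beta>' \<tau>) d"
    proof (cases "d \<in> charts_at M (\<gamma> \<tau>)")
      case True
      have "vector_derivative (snd d \<circ> \<gamma>) (at \<tau> within {s..t}) =
          frechet_derivative (transition c d) (at (\<beta> \<tau>)) (\<beta>' \<tau>)"
        using der[OF \<tau> True] \<tau> \<open>s < t\<close> by (intro vector_derivative_within_closed_interval) auto
      then show ?thesis
        using True chart(2)[OF \<tau>] by (simp add: velocity_def tangent_of_def)
    qed (simp add: velocity_def tangent_of_def)
  qed
  have contv: "continuous_on ({s..t} \<inter> \<gamma> -` fst d) (\<lambda>\<tau>. velocity M \<gamma> {s..t} \<tau> d)" if d: "d \<in> atlas M" for d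
  proof -
    have "continuous_on ({s..t} \<inter> \<gamma> -` fst d) (\<lambda>\<tau>. frechet_derivative (transition c d) (at (\<beta> \<tau>)) (\<beta>' \<tau>))"
    proof (rule continuous_on_linear_family[of _ "\<lambda>\<tau>. frechet_derivative (transition c d) (at (\<beta> \<tau>))"])
      show "continuous_on ({s..t} \<inter> \<gamma> -` fst d) \<beta>'"
        using \<beta>' continuous_on_subset by blast
      show "linear (frechet_derivative (transition c d) (at (\<beta> \<tau>)))" if "\<tau> \<in> {s..t} \<inter> \<gamma> -` fst d" for \<tau>
        using linear_transition_derivative[of c "\<gamma> \<tau>" d] chart[of \<tau>] that d by (auto simp: charts_at_def)
      show "continuous_on ({s..t} \<inter> \<gamma> -` fst d) (\<lambda>\<tau>. frechet_derivative (transition c d) (at (\<beta> \<tau>)) v)" for v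
      proof (rule continuous_on_compose2[where f = \<beta> and
            g = "\<lambda>x. frechet_derivative (transition c d) (at x) v"])
        show "continuous_on (snd c ` (fst c \<inter> fst d)) (\<lambda>x. frechet_derivative (transition c d) (at x) v)"
          using transition_C1[OF c d] by simp
        show "continuous_on ({s..t} \<inter> \<gamma> -` fst d) \<beta>"
          using cont\<beta> continuous_on_subset by blast
        show "\<beta> ` ({s..t} \<inter> \<gamma> -` fst d) \<subseteq> snd c ` (fst c \<inter> fst d)"
        proof (intro image_subsetI)
          fix \<tau> assume "\<tau> \<in> {s..t} \<inter> \<gamma> -` fst d"
          then show "\<beta> \<tau> \<in> snd c ` (fst c \<inter> fst d)"
            using chart[of \<tau>] by (intro image_eqI[of _ _ "\<gamma> \<tau>"]) (auto simp: charts_at_def)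
        qed
      qed
    qed
    then show ?thesis
    proof (rule continuous_on_eq)
      fix \<tau> assume \<tau>: "\<tau> \<in> {s..t} \<inter> \<gamma> -` fst d"
      then have "d \<in> charts_at M (\<gamma> \<tau>)" using d by (simp add: charts_at_def)
      then show "frechet_derivative (transition c d) (at (\<beta> \<tau>)) (\<beta>' \<tau>) = velocity M \<gamma> {s..t} \<tau> d"
        using \<tau> vel[of \<tau>] chart(2)[of \<tau>] by (simp add: tangent_of_def)
    qed
  qed
  have "continuous_map (top_of_set {s..t}) (topol M) \<gamma>"
    unfolding \<gamma>_def
    by (rule continuous_map_compose[OF _ continuous_map_param[OF c]]) (use cont\<beta> in_c in auto)
  moreover have "(snd d \<circ> \<gamma>) differentiable (at \<tau> within {s..t})"
    if "d \<in> atlas M" "\<tau> \<in> {s..t} \<inter> \<gamma> -` fst d" for d \<tau>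
    using der[of \<tau> d] that by (intro differentiableI_vector) (auto simp: charts_at_def)
  ultimately have "C1_curve M \<gamma> {s..t}"
    using contv by (simp add: C1_curve_def)
  moreover have "velocity M \<gamma> {s..t} \<tau> \<in> future M (\<gamma> \<tau>)" if "\<tau> \<in> {s..t}" for \<tau>
    using vel[OF that] cone[OF that] by (simp add: cone_bundle_def \<gamma>_def)
  ultimately show ?thesis
    using \<open>s < t\<close> by (simp add: timelike_piece_def \<gamma>_def)
qed

section \<open>The chronological relation\<close>

lemma in_closure_chron_future:
  assumes x: "x \<in> points M"
  shows "x \<in> topol M closure_of chron_future M x"
  unfolding in_closure_of
proof (intro conjI allI impI)
  fix T assume T: "x \<in> T \<and> openin (topol M) T"
  obtain c where c: "c \<in> atlas M" "x \<in> fst c" using obtain_chart[OF x] by metis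
  obtain v where v: "v \<in> future M x" using future_nonempty[OF x] by blast
  define x0 where "x0 = snd c x"
  define u where "u = v c"
  define \<beta> where "\<beta> = (\<lambda>\<tau>. x0 + \<tau> *\<^sub>R u)"
  \<comment> \<open>The set \<open>?O\<close> combines both demands on the segment: the constant
    velocity \<open>u\<close> is future-directed at the current point, and that point lies in
    \<open>T\<close>.\<close>
  have "open (cone_bundle M c \<inter> (snd c ` (fst c \<inter> T) \<times> UNIV))" (is "open ?O")
    using c T by (intro open_Int open_Times open_cone_bundle open_chart_image_openin) auto
  moreover have "continuous_on UNIV (\<lambda>\<tau>. (\<beta> \<tau>, u))"
    unfolding \<beta>_def by (intro continuous_intros)
  ultimately have "open ((\<lambda>\<tau>. (\<beta> \<tau>, u)) -` ?O)"
    using open_vimage by blast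
  moreover have "0 \<in> (\<lambda>\<tau>. (\<beta> \<tau>, u)) -` ?O"
    using future_component_in_cone_bundle[OF c v] c T by (auto simp: \<beta>_def x0_def u_def)
  \<comment> \<open>A closed ball is taken so that the end point of the segment, at parameter
    \<open>\<epsilon>\<close>, is included.\<close>
  ultimately obtain \<epsilon> where "\<epsilon> > 0" and \<epsilon>: "cball 0 \<epsilon> \<subseteq> (\<lambda>\<tau>. (\<beta> \<tau>, u)) -` ?O"
    by (meson open_contains_cball)
  have inO: "(\<beta> \<tau>, u) \<in> ?O" if "\<tau> \<in> {0..\<epsilon>}" for \<tau>
    using \<epsilon> that by (auto simp: subset_iff)
  have "timelike_piece M (param c \<circ> \<beta>) 0 \<epsilon>"
  proof (rule timelike_piece_in_chart[OF c(1) \<open>\<epsilon> > 0\<close>, where \<beta>' = "\<lambda>_. u"])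
    show "(\<beta> has_vector_derivative u) (at \<tau> within {0..\<epsilon>})" for \<tau>
      unfolding \<beta>_def by (auto intro!: derivative_eq_intros)
  qed (use inO in auto)
  then have "(param c (\<beta> 0), param c (\<beta> \<epsilon>)) \<in> chron_rel M"
    using piece_relI by (fastforce simp: chron_rel_eq_trancl)
  moreover have "param c (\<beta> 0) = x" using c by (simp add: \<beta>_def x0_def)
  moreover have "param c (\<beta> \<epsilon>) \<in> T"
    using inO[of \<epsilon>] \<open>\<epsilon> > 0\<close> c by auto
  ultimately show "\<exists>y. y \<in> chron_future M x \<and> y \<in> T"
    by (auto simp: chron_future_def)
qed fact

text \<open>The initial point of a curve is moved in a chart by adding to the curve a small vector field
  that decreases linearly to \<open>0\<close>; the cone bundle is open, so the velocity stays timelike.\<close>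

lemma piece_rel_neighbourhood:
  assumes "(p, q) \<in> piece_rel M"
  shows "\<exists>N. openin (topol M) N \<and> p \<in> N \<and> N \<subseteq> chron_past M q"
proof -
  obtain \<gamma> s t where piece: "timelike_piece M \<gamma> s t" and p: "p = \<gamma> s" and q: "q = \<gamma> t"
    using assms by (auto simp: piece_rel_def)
  have st: "s < t" and C1: "C1_curve M \<gamma> {s..t}"
    and fut: "\<And>\<tau>. \<tau> \<in> {s..t} \<Longrightarrow> velocity M \<gamma> {s..t} \<tau> \<in> future M (\<gamma> \<tau>)"
    using piece by (auto simp: timelike_piece_def)
  have cont: "continuous_map (top_of_set {s..t}) (topol M) \<gamma>"
    using C1 by (simp add: C1_curve_def)
  then have "p \<in> points M"
    using st by (auto simp: p continuous_map_def Pi_iff)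
  then obtain c where c: "c \<in> atlas M" "p \<in> fst c" using obtain_chart by metis
  have "openin (top_of_set {s..t}) {\<tau> \<in> {s..t}. \<gamma> \<tau> \<in> fst c}"
    using openin_continuous_map_preimage[OF cont openin_chart[OF c(1)]] by simp
  moreover have "s \<in> {\<tau> \<in> {s..t}. \<gamma> \<tau> \<in> fst c}"
    using c st by (simp add: p)
  ultimately obtain \<epsilon> where "\<epsilon> > 0" and \<epsilon>: "cball s \<epsilon> \<inter> {s..t} \<subseteq> {\<tau> \<in> {s..t}. \<gamma> \<tau> \<in> fst c}"
    unfolding openin_contains_cball by blast
  \<comment> \<open>Up to \<open>t1\<close> the curve remains in the chart; the midpoint keeps
    \<open>t1 < t\<close>, so that a piece on \<open>{t1..t}\<close> is left over.\<close>
  define t1 where "t1 = min (s + \<epsilon>) ((s + t) / 2)"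
  have t1: "s < t1" "t1 < t"
    using st \<open>\<epsilon> > 0\<close> by (auto simp: t1_def min_less_iff_disj)
  have in_c: "\<gamma> \<tau> \<in> fst c" if "\<tau> \<in> {s..t1}" for \<tau>
    using \<epsilon> that t1 by (auto simp: subset_iff dist_real_def t1_def)
  define \<beta> where "\<beta> = snd c \<circ> \<gamma>"
  define \<beta>' where "\<beta>' = (\<lambda>\<tau>. velocity M \<gamma> {s..t} \<tau> c)"
  have der: "(\<beta> has_vector_derivative \<beta>' \<tau>) (at \<tau> within {s..t1})" if \<tau>: "\<tau> \<in> {s..t1}" for \<tau>
  proof -
    have "\<beta> differentiable (at \<tau> within {s..t})"
      using C1 c in_c[OF \<tau>] \<tau> t1 by (auto simp: C1_curve_def \<beta>_def)
    then have "(\<beta> has_vector_derivative \<beta>' \<tau>) (at \<tau> within {s..t})"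
      using c in_c[OF \<tau>] by (simp add: \<beta>'_def \<beta>_def velocity_def charts_at_def vector_derivative_works)
    then show ?thesis
      by (rule has_vector_derivative_within_subset) (use t1 in auto)
  qed
  have cont\<beta>: "continuous_on {s..t1} \<beta>"
    using der has_vector_derivative_continuous continuous_on_eq_continuous_within by blast
  have "continuous_on ({s..t} \<inter> \<gamma> -` fst c) \<beta>'"
    using C1 c by (simp add: C1_curve_def \<beta>'_def)
  then have cont\<beta>': "continuous_on {s..t1} \<beta>'"
    by (rule continuous_on_subset) (use in_c t1 in auto)
  \<comment> \<open>Compactness of the lifted curve gives one radius \<open>\<delta>\<close> that is
    safe for all parameters at once.\<close>
  have "compact ((\<lambda>\<tau>. (\<beta> \<tau>, \<beta>' \<tau>)) ` {s..t1})"
    using cont\<beta> cont\<beta>' by (intro compact_continuous_image continuous_intros) auto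
  moreover have "(\<lambda>\<tau>. (\<beta> \<tau>, \<beta>' \<tau>)) ` {s..t1} \<subseteq> cone_bundle M c"
    using future_component_in_cone_bundle[OF c(1) in_c] fut t1 by (auto simp: \<beta>_def \<beta>'_def)
  ultimately obtain \<delta> where "\<delta> > 0"
    and \<delta>: "(\<Union>z \<in> (\<lambda>\<tau>. (\<beta> \<tau>, \<beta>' \<tau>)) ` {s..t1}. ball z \<delta>) \<subseteq> cone_bundle M c"
    using compact_subset_open_imp_ball_epsilon_subset[OF _ open_cone_bundle[OF c(1)]] by metis
  \<comment> \<open>A shift \<open>h\<close> of the initial point changes positions by at most
    \<open>norm h\<close> and velocities by \<open>norm h / (t1 - s)\<close>; this bound keeps each
    below \<open>\<delta> / 2\<close>.\<close>
  define \<eta> where "\<eta> = min (\<delta> / 2) (\<delta> / 2 * (t1 - s))"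
  have "\<eta> > 0" using \<open>\<delta> > 0\<close> t1 by (simp add: \<eta>_def)
  define N where "N = {p' \<in> fst c. snd c p' \<in> ball (snd c p) \<eta>}"
  have "p' \<in> chron_past M q" if "p' \<in> N" for p'
  proof -
    define h where "h = snd c p' - snd c p"
    have p': "p' \<in> fst c" and "norm h < \<eta>"
      using that by (auto simp: N_def h_def dist_norm norm_minus_commute)
    then have h1: "norm h < \<delta> / 2" and h2: "norm h / (t1 - s) < \<delta> / 2"
      using t1 by (auto simp: \<eta>_def divide_simps)
    \<comment> \<open>With this slope the factor \<open>(t1 - \<tau>) * k\<close> decreases from
      \<open>1\<close> at \<open>s\<close>, where the new curve starts at \<open>p'\<close>, to
      \<open>0\<close> at \<open>t1\<close>, where it meets \<open>\<gamma>\<close>.\<close>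
    define k where "k = 1 / (t1 - s)"
    define \<beta>h where "\<beta>h = (\<lambda>\<tau>. \<beta> \<tau> + ((t1 - \<tau>) * k) *\<^sub>R h)"
    define \<beta>h' where "\<beta>h' = (\<lambda>\<tau>. \<beta>' \<tau> - k *\<^sub>R h)"
    have "timelike_piece M (param c \<circ> \<beta>h) s t1"
    proof (rule timelike_piece_in_chart[OF c(1) t1(1), where \<beta>' = \<beta>h'])
      fix \<tau> assume \<tau>: "\<tau> \<in> {s..t1}"
      have "((\<lambda>\<tau>. ((t1 - \<tau>) * k) *\<^sub>R h) has_vector_derivative (- k) *\<^sub>R h)
          (at \<tau> within {s..t1})"
        by (auto intro!: derivative_eq_intros)
      from has_vector_derivative_add[OF der[OF \<tau>] this]
      show "(\<beta>h has_vector_derivative \<beta>h' \<tau>) (at \<tau> within {s..t1})"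
        by (simp add: \<beta>h_def \<beta>h'_def)
      have "dist (\<beta> \<tau>, \<beta>' \<tau>) (\<beta>h \<tau>, \<beta>h' \<tau>) \<le> dist (\<beta> \<tau>) (\<beta>h \<tau>) + dist (\<beta>' \<tau>) (\<beta>h' \<tau>)"
        unfolding dist_Pair_Pair by (rule sqrt_sum_squares_le_sum) auto
      also have "dist (\<beta> \<tau>) (\<beta>h \<tau>) = ((t1 - \<tau>) / (t1 - s)) * norm h"
        using \<tau> t1 by (simp add: \<beta>h_def dist_norm k_def)
      also have "\<dots> \<le> 1 * norm h"
        using \<tau> t1 by (intro mult_right_mono) auto
      also have "dist (\<beta>' \<tau>) (\<beta>h' \<tau>) = norm h / (t1 - s)"
        using t1 by (simp add: \<beta>h'_def dist_norm k_def)
      finally have "dist (\<beta> \<tau>, \<beta>' \<tau>) (\<beta>h \<tau>, \<beta>h' \<tau>) < \<delta>"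
        using h1 h2 by linarith
      then have "(\<beta>h \<tau>, \<beta>h' \<tau>) \<in> (\<Union>z \<in> (\<lambda>\<tau>. (\<beta> \<tau>, \<beta>' \<tau>)) ` {s..t1}. ball z \<delta>)"
        by (intro UN_I[OF imageI[OF \<tau>]]) simp
      then show "(\<beta>h \<tau>, \<beta>h' \<tau>) \<in> cone_bundle M c"
        by (rule subsetD[OF \<delta>])
    next
      show "continuous_on {s..t1} \<beta>h'"
        unfolding \<beta>h'_def by (intro continuous_intros cont\<beta>')
    qed
    then have "(param c (\<beta>h s), param c (\<beta>h t1)) \<in> piece_rel M"
      using piece_relI by fastforce
    moreover have "param c (\<beta>h s) = p'"
      using c p' t1 by (simp add: \<beta>h_def \<beta>_def h_def k_def p)
    moreover have "param c (\<beta>h t1) = \<gamma> t1"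
      using c in_c[of t1] t1 by (simp add: \<beta>h_def \<beta>_def)
    ultimately have "(p', \<gamma> t1) \<in> piece_rel M" by simp
    \<comment> \<open>The velocity may jump at \<open>t1\<close>, so the perturbed arc and the rest
      of \<open>\<gamma>\<close> are kept as two steps of \<open>piece_rel\<close>.\<close>
    moreover have "timelike_piece M \<gamma> t1 t"
      by (rule timelike_piece_shift[OF piece, where k = 0]) (use t1 in auto)
    then have "(\<gamma> t1, q) \<in> piece_rel M"
      unfolding q by (rule piece_relI)
    ultimately show ?thesis
      by (auto simp: chron_past_def chron_rel_eq_trancl)
  qed
  moreover have "openin (topol M) N"
    unfolding N_def using openin_chart_vimage[OF c(1)] by blast
  moreover have "p \<in> N" using c \<open>\<eta> > 0\<close> by (simp add: N_def)
  ultimately show ?thesis by blast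
qed

text \<open>Only the first piece of a chain from \<open>p\<close> to \<open>q\<close> has to be
  moved; the remaining chain is attached by transitivity.\<close>

lemma openin_chron_past: "openin (topol M) (chron_past M q)"
proof (subst openin_subopen, intro ballI)
  fix p assume "p \<in> chron_past M q"
  then have "(p, q) \<in> (piece_rel M)\<^sup>+"
    by (simp add: chron_past_def chron_rel_eq_trancl)
  then obtain q' where q': "(p, q') \<in> piece_rel M" "q' = q \<or> (q', q) \<in> chron_rel M"
    by (metis chron_rel_eq_trancl converse_tranclE)
  obtain N where "openin (topol M) N" "p \<in> N" "N \<subseteq> chron_past M q'"
    using piece_rel_neighbourhood[OF q'(1)] by blast
  moreover have "chron_past M q' \<subseteq> chron_past M q"
    using q'(2) by (auto simp: chron_past_def intro: chron_rel_trans)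
  ultimately show "\<exists>N. openin (topol M) N \<and> p \<in> N \<and> N \<subseteq> chron_past M q" by blast
qed

section \<open>Order properties of \<open>D_future\<close>\<close>

lemma D_future_chron_future:
  assumes "(x, y) \<in> D_future M"
  shows "chron_future M y \<subseteq> chron_future M x"
proof
  fix w assume "w \<in> chron_future M y"
  then have "y \<in> chron_past M w" by (simp add: chron_future_def chron_past_def)
  moreover have "y \<in> topol M closure_of chron_future M x"
    using assms by (simp add: D_future_def)
  \<comment> \<open>The open set \<open>chron_past M w\<close> is a neighbourhood of
    \<open>y\<close>, hence meets \<open>chron_future M x\<close>; a common point \<open>v\<close>
    is an intermediate point between \<open>x\<close> and \<open>w\<close>.\<close>
  ultimately obtain v where "v \<in> chron_future M x" "v \<in> chron_past M w"
    using openin_chron_past unfolding in_closure_of by blast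
  then show "w \<in> chron_future M x"
    by (auto simp: chron_future_def chron_past_def intro: chron_rel_trans)
qed

lemma causal_relation_D_future: "causal_relation M (D_future M)"
proof -
  have "chron_future M x \<subseteq> topol M closure_of chron_future M x" for x
    using chron_rel_subset by (intro closure_of_subset) (auto simp: chron_future_def)
  then show ?thesis
    unfolding causal_relation_def D_future_def using chron_rel_subset
    by (fastforce simp: chron_future_def)
qed

lemma refl_D_future: "refl_on (points M) (D_future M)"
  by (auto simp: refl_on_def D_future_def in_closure_chron_future)

text \<open>The inclusion of the future of \<open>y\<close> in that of \<open>x\<close> passes to
  closures.\<close>

lemma trans_D_future: "trans (D_future M)"
proof (rule transI)
  fix x y z assume xy: "(x, y) \<in> D_future M" and yz: "(y, z) \<in> D_future M"
  then show "(x, z) \<in> D_future M"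
    using closure_of_mono[OF D_future_chron_future[OF xy]] by (auto simp: D_future_def)
qed

text \<open>Being related in both directions is the same as having equal futures: equal futures have
  equal closures, which contain both points, and conversely \<open>D_future_chron_future\<close>
  gives both inclusions.\<close>

lemma antisym_D_future: "antisym (D_future M) \<longleftrightarrow> future_distinguishing M"
proof
  assume "antisym (D_future M)"
  moreover have "(x, z) \<in> D_future M" if "x \<in> points M" "z \<in> points M" "chron_future M x = chron_future M z" for x z
    using that in_closure_chron_future[of z] by (simp add: D_future_def)
  ultimately show "future_distinguishing M"
    by (auto simp: future_distinguishing_def dest: antisymD)
next
  assume fd: "future_distinguishing M"
  show "antisym (D_future M)"
  proof (rule antisymI)
    fix x y assume "(x, y) \<in> D_future M" "(y, x) \<in> D_future M"
    then show "x = y"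
      using D_future_chron_future[of x y] D_future_chron_future[of y x] fd
      by (auto simp: future_distinguishing_def D_future_def)
  qed
qed

end

section \<open>Time reversal\<close>

text \<open>Topology, charts and metric are kept and the cones negated; \<open>uminus\<close> acts
  on a tangent vector componentwise in the charts.\<close>

definition time_reverse :: "('m, 'e::euclidean_space) lorentz \<Rightarrow> ('m, 'e) lorentz" where
  "time_reverse M = M\<lparr>future := \<lambda>p. uminus ` future M p\<rparr>"

lemma time_reverse_simps [simp]:
  "topol (time_reverse M) = topol M" "atlas (time_reverse M) = atlas M"
  "metric (time_reverse M) = metric M" "future (time_reverse M) p = uminus ` future M p"
  "charts_at (time_reverse M) p = charts_at M p"
  by (simp_all add: time_reverse_def charts_at_def)

lemma time_reverse_cong [simp]:
  "tangent_space (time_reverse M) = tangent_space M" "tangent_of (time_reverse M) = tangent_of M"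
  "velocity (time_reverse M) = velocity M"
  by (auto simp: fun_eq_iff tangent_space_def tangent_of_def velocity_def)

lemma time_reverse_cong2 [simp]:
  "metric_in (time_reverse M) = metric_in M" "timelike_vectors (time_reverse M) = timelike_vectors M"
  "C1_curve (time_reverse M) = C1_curve M"
  by (auto simp: fun_eq_iff metric_in_def timelike_vectors_def C1_curve_def)

lemma time_reverse_time_reverse [simp]:
  fixes M :: "('m, 'e::euclidean_space) lorentz"
  shows "time_reverse (time_reverse M) = M"
proof -
  have "- (- v) = v" for v :: "('m, 'e) tvector"
    by (simp add: fun_eq_iff)
  then show ?thesis by (simp add: time_reverse_def image_image)
qed

text \<open>The substitution of \<open>s + t - \<tau>\<close> for \<open>\<tau>\<close> maps
  \<open>{s..t}\<close> to itself, exchanges the end points and negates velocities: it is the affine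
  reparametrisation of slope \<open>-1\<close>.\<close>

lemma piece_rel_time_reverse_subset: "(piece_rel M)\<inverse> \<subseteq> piece_rel (time_reverse M)"
proof clarify
  fix p q assume "(p, q) \<in> piece_rel M"
  then obtain \<gamma> s t where pq: "p = \<gamma> s" "q = \<gamma> t" and st: "s < t" and C1: "C1_curve M \<gamma> {s..t}"
    and fut: "\<And>\<tau>. \<tau> \<in> {s..t} \<Longrightarrow> velocity M \<gamma> {s..t} \<tau> \<in> future M (\<gamma> \<tau>)"
    by (auto simp: piece_rel_def timelike_piece_def)
  define \<gamma>' where "\<gamma>' = (\<lambda>\<tau>. \<gamma> (s + t - \<tau>))"
  have "C1_curve M \<gamma>' {s..t}"
    by (rule C1_curve_affine_reparam(1)[OF C1 st, of "-1" "s + t"]) (auto simp: \<gamma>'_def)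
  moreover have "velocity M \<gamma>' {s..t} \<tau> \<in> uminus ` future M (\<gamma>' \<tau>)" if \<tau>: "\<tau> \<in> {s..t}" for \<tau>
  proof -
    have "velocity M \<gamma>' {s..t} \<tau> = (\<lambda>c. (-1) *\<^sub>R velocity M \<gamma> {s..t} (-1 * \<tau> + (s + t)) c)"
      by (rule C1_curve_affine_reparam(2)[OF C1 st]) (use \<tau> in \<open>auto simp: \<gamma>'_def\<close>)
    then have "velocity M \<gamma>' {s..t} \<tau> = - velocity M \<gamma> {s..t} (s + t - \<tau>)"
      by (simp add: fun_eq_iff)
    then show ?thesis
      using fut[of "s + t - \<tau>"] \<tau> by (auto simp: \<gamma>'_def)
  qed
  ultimately have "timelike_piece (time_reverse M) \<gamma>' s t"
    using st by (simp add: timelike_piece_def)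
  from piece_relI[OF this] show "(q, p) \<in> piece_rel (time_reverse M)"
    by (simp add: \<gamma>'_def pq)
qed

text \<open>Time reversal is an involution, so the inclusion for pieces, used for \<open>M\<close>
  and for its reversal, is an equality; taking converses commutes with transitive closure.\<close>

lemma chron_rel_time_reverse: "chron_rel (time_reverse M) = (chron_rel M)\<inverse>"
proof -
  have "piece_rel (time_reverse M) = (piece_rel M)\<inverse>"
    using piece_rel_time_reverse_subset[of M] piece_rel_time_reverse_subset[of "time_reverse M"] by auto
  then show ?thesis by (simp add: chron_rel_eq_trancl trancl_converse)
qed

text \<open>\<open>D_future\<close> takes the closure in its second variable and
  \<open>D_past\<close> in its first, which is why the converse appears.\<close>

lemma D_future_time_reverse: "D_future (time_reverse M) = (D_past M)\<inverse>"
  by (auto simp: D_future_def D_past_def chron_future_def chron_past_def chron_rel_time_reverse)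

lemma future_distinguishing_time_reverse:
  "future_distinguishing (time_reverse M) \<longleftrightarrow> past_distinguishing M"
  by (simp add: future_distinguishing_def past_distinguishing_def chron_future_def chron_past_def
      chron_rel_time_reverse)

text \<open>If \<open>X\<close> orients \<open>M\<close> near a point, then \<open>- X\<close>
  orients the reversed structure there. The remaining clauses of \<open>spacetime\<close> do not
  refer to the cones.\<close>

lemma (in spacetime_manifold) spacetime_time_reverse: "spacetime r (time_reverse M)"
proof -
  have "time_orientation (time_reverse M)"
    unfolding time_orientation_def
  proof
    fix p assume "p \<in> points (time_reverse M)"
    then have "p \<in> points M" by simp
    then obtain U X where U: "openin (topol M) U" "p \<in> U"
      and X: "\<forall>q\<in>U. X q \<in> timelike_vectors M q"
      and contX: "\<forall>c\<in>atlas M.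
        continuous_map (subtopology (topol M) (U \<inter> fst c)) euclidean (\<lambda>q. X q c)"
      and fut: "\<forall>q\<in>U. future M q = {v \<in> timelike_vectors M q. metric M q (X q) v < 0}"
      by (rule obtain_orientation)
    note X = X[rule_format] and contX = contX[rule_format] and fut = fut[rule_format]
    have neg: "- v \<in> timelike_vectors M q" if "q \<in> points M" "v \<in> timelike_vectors M q" for q v
      using that by (simp add: timelike_vectors_def uminus_tangent_space metric_uminus)
    \<comment> \<open>A vector \<open>v\<close> is in the negated cone when \<open>- v\<close> is in
      the cone, and the metric takes the same value on \<open>(X, - v)\<close> and on
      \<open>(- X, v)\<close>.\<close>
    have fut': "uminus ` future M q = {v \<in> timelike_vectors M q. metric M q (- X q) v < 0}"
      if q: "q \<in> U" for q
    proof -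
      have qM: "q \<in> points M" using q U openin_subset by blast
      have *: "metric M q (- X q) v = - metric M q (X q) v" "metric M q (X q) (- v) = - metric M q (X q) v"
        if "v \<in> timelike_vectors M q" for v
        using metric_uminus[OF qM] X[OF q] that by (auto simp: timelike_vectors_def)
      show ?thesis
        unfolding fut[OF q]
      proof (intro equalityI subsetI)
        fix v assume "v \<in> {v \<in> timelike_vectors M q. metric M q (- X q) v < 0}"
        then have v: "v \<in> timelike_vectors M q" "metric M q (- X q) v < 0" by auto
        have "- v \<in> {v \<in> timelike_vectors M q. metric M q (X q) v < 0}"
          using neg[OF qM v(1)] v(2) *[OF v(1)] by simp
        then show "v \<in> uminus ` {v \<in> timelike_vectors M q. metric M q (X q) v < 0}"
          by (rule rev_image_eqI) (simp add: fun_eq_iff)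
      qed (use neg[OF qM] * in auto)
    qed
    have "continuous_map (subtopology (topol M) (U \<inter> fst c)) euclidean (\<lambda>q. (- X q) c)"
      if "c \<in> atlas M" for c
      using continuous_map_minus[OF contX[OF that]] by simp
    then show "\<exists>U X. openin (topol (time_reverse M)) U \<and> p \<in> U \<and>
        (\<forall>q\<in>U. X q \<in> timelike_vectors (time_reverse M) q) \<and>
        (\<forall>c\<in>atlas (time_reverse M). continuous_map (subtopology (topol (time_reverse M)) (U \<inter> fst c))
           euclidean (\<lambda>q. X q c)) \<and>
        (\<forall>q\<in>U. future (time_reverse M) q =
           {v \<in> timelike_vectors (time_reverse M) q. metric (time_reverse M) q (X q) v < 0})"
      using U X neg fut' openin_subset[OF U(1)]
      by (intro exI[of _ U] exI[of _ "\<lambda>q. - X q"]) auto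
  qed
  then show ?thesis
    using spacetime by (simp add: spacetime_def Cr_manifold_def lorentzian_metric_def)
qed

theorem theorem3p3:
  fixes r :: enat and M :: "('m, 'e::euclidean_space) lorentz"
  assumes "spacetime r M"
  shows "(causal_relation M (D_future M) \<and> refl_on (points M) (D_future M) \<and> trans (D_future M)) \<and>
    (causal_relation M (D_past M) \<and> refl_on (points M) (D_past M) \<and> trans (D_past M)) \<and>
    (antisym (D_future M) \<longleftrightarrow> future_distinguishing M) \<and>
    (partial_order_on (points M) (D_future M) \<longleftrightarrow> future_distinguishing M) \<and>
    (antisym (D_past M) \<longleftrightarrow> past_distinguishing M) \<and>
    (partial_order_on (points M) (D_past M) \<longleftrightarrow> past_distinguishing M)"
proof -
  interpret F: spacetime_manifold r M
    by unfold_locales fact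
  interpret P: spacetime_manifold r "time_reverse M"
    by unfold_locales (rule F.spacetime_time_reverse)
  have D_past: "D_past M = (D_future (time_reverse M))\<inverse>"
    by (simp add: D_future_time_reverse)
  have "causal_relation M (D_past M)"
    using P.causal_relation_D_future
    by (auto simp: causal_relation_def D_future_time_reverse chron_rel_time_reverse)
  moreover have "refl_on (points M) (D_past M)" "trans (D_past M)"
    using P.refl_D_future P.trans_D_future unfolding D_past by auto
  moreover have "antisym (D_past M) \<longleftrightarrow> past_distinguishing M"
    using P.antisym_D_future unfolding D_past by (simp add: future_distinguishing_time_reverse)
  \<comment> \<open>Reflexivity and transitivity being settled, a partial order amounts to
    antisymmetry; containment in \<open>points M \<times> points M\<close> is part of
    \<open>causal_relation\<close>.\<close>
  ultimately show ?thesis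
    using F.causal_relation_D_future F.refl_D_future F.trans_D_future F.antisym_D_future
    by (auto simp: partial_order_on_def preorder_on_def causal_relation_def)
qed

end
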